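(* Let $\Sigma\subseteq\mathbb{F}'_{(\infty)}$ be a consistent set of propositions and let $\Sigma'\supseteq\Sigma$ be a maximal consistent extension of $\Sigma$ in $\mathbb{F}'_{(\infty)}$. Define $$\tilde{\vee}:\Sigma'\times\Sigma'\to\Sigma',\quad(\alpha,\beta)\mapsto\alpha\vee\beta,$$ $$\tilde{l}:\Sigma'\times\Sigma'\to\Sigma',\quad(\alpha,\beta)\mapsto\alpha\, l\,\beta:=(\neg\alpha\vee\beta)\wedge(\neg\beta\vee\alpha).$$ Then $(\Sigma',\tilde{l},\tilde{\vee})$ is a commutative ring, with $\tilde{l}$ as addition and $\tilde{\vee}$ as multiplication.
   Context: $\mathcal{A}$ is a countably infinite alphabet. Put $\mathbb{F}_0=\mathcal{A}$, $\mathbb{F}_n=\{\neg\alpha\mid\alpha\in\mathbb{F}_{n-1}\}\cup\{(\alpha\ast\beta)\mid\alpha,\beta\in\mathbb{F}_{n-1},\ \ast\in\{\vee,\wedge\}\}\cup\mathbb{F}_{n-1}$, and $\mathbb{F}_{(\infty)}=\bigcup_{n\ge 0}\mathbb{F}_n$. Write $\alpha\equiv\beta$ iff $\hat v(\alpha)=\hat v(\beta)$ for every boolean valuation $v:\mathbb{F}_0\to\{0,1\}$ (with $\hat v$ its extension to formulas). Then $\mathbb{F}'_{(\infty)}=\mathbb{F}_{(\infty)}/\equiv$ (the Lindenbaum algebra over $\mathcal{A}$), with $\wedge,\vee,\neg$ defined on classes through representatives. Consistency is in the usual sense of classical propositional logic; a maximal consistent set is closed under deduction. "Ring" does not require a multiplicative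 identity. *)

theory Defs
  imports "HOL-Library.Countable_Set" "HOL-Algebra.Group"
begin

datatype 'a form =
    Atom 'a
  | Neg "'a form"
  | Or "'a form" "'a form"
  | And "'a form" "'a form"

fun level :: "nat \<Rightarrow> 'a form set" where
  "level 0 = range Atom"
| "level (Suc n) = {Neg \<alpha> | \<alpha>. \<alpha> \<in> level n}
     \<union> {Or \<alpha> \<beta> | \<alpha> \<beta>. \<alpha> \<in> level n \<and> \<beta> \<in> level n}
     \<union> {And \<alpha> \<beta> | \<alpha> \<beta>. \<alpha> \<in> level n \<and> \<beta> \<in> level n}
     \<union> level n"

lemma level_mono: "m \<le> n \<Longrightarrow> level m \<subseteq> level n"
  by (rule lift_Suc_mono_le) auto

(* The datatype is exactly the union of the finite stages, so the set of all
   formulas is the whole type. *)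
lemma Union_level: "(\<Union>n. level n) = (UNIV :: 'a form set)"
proof -
  have "\<exists>n. \<phi> \<in> level n" for \<phi> :: "'a form"
  proof (induction \<phi>)
    case (Atom x)
    have "Atom x \<in> level 0" by simp
    then show ?case by blast
  next
    case (Neg \<phi>)
    then obtain n where "\<phi> \<in> level n" by blast
    then have "Neg \<phi> \<in> level (Suc n)" by simp
    then show ?case by blast
  next
    case (Or \<phi> \<psi>)
    then obtain m n where "\<phi> \<in> level m" "\<psi> \<in> level n" by blast
    then have "\<phi> \<in> level (max m n)" "\<psi> \<in> level (max m n)"
      using level_mono[of m "max m n"] level_mono[of n "max m n"] by auto
    then have "Or \<phi> \<psi> \<in> level (Suc (max m n))" by simp
    then show ?case by blast
  next
    case (And \<phi> \<psi>)
    then obtain m n where "\<phi> \<in> level m" "\<psi> \<in> level n" by blast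
    then have "\<phi> \<in> level (max m n)" "\<psi> \<in> level (max m n)"
      using level_mono[of m "max m n"] level_mono[of n "max m n"] by auto
    then have "And \<phi> \<psi> \<in> level (Suc (max m n))" by simp
    then show ?case by blast
  qed
  then show ?thesis by auto
qed

fun eval_form :: "('a \<Rightarrow> bool) \<Rightarrow> 'a form \<Rightarrow> bool" where
  "eval_form v (Atom x) \<longleftrightarrow> v x"
| "eval_form v (Neg \<alpha>) \<longleftrightarrow> \<not> eval_form v \<alpha>"
| "eval_form v (Or \<alpha> \<beta>) \<longleftrightarrow> eval_form v \<alpha> \<or> eval_form v \<beta>"
| "eval_form v (And \<alpha> \<beta>) \<longleftrightarrow> eval_form v \<alpha> \<and> eval_form v \<beta>"

definition form_equiv :: "'a form \<Rightarrow> 'a form \<Rightarrow> bool" where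
  "form_equiv \<alpha> \<beta> \<longleftrightarrow> (\<forall>v. eval_form v \<alpha> = eval_form v \<beta>)"

quotient_type 'a lindenbaum = "'a form" / form_equiv
  by (rule equivpI) (auto simp: form_equiv_def reflp_def symp_def transp_def)

lift_definition lneg :: "'a lindenbaum \<Rightarrow> 'a lindenbaum" is Neg
  by (simp add: form_equiv_def)

lift_definition lor :: "'a lindenbaum \<Rightarrow> 'a lindenbaum \<Rightarrow> 'a lindenbaum" is Or
  by (simp add: form_equiv_def)

lift_definition land :: "'a lindenbaum \<Rightarrow> 'a lindenbaum \<Rightarrow> 'a lindenbaum" is And
  by (simp add: form_equiv_def)

definition lbic :: "'a lindenbaum \<Rightarrow> 'a lindenbaum \<Rightarrow> 'a lindenbaum" where
  "lbic \<alpha> \<beta> = land (lor (lneg \<alpha>) \<beta>) (lor (lneg \<beta>) \<alpha>)"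

abbreviation Imp :: "'a form \<Rightarrow> 'a form \<Rightarrow> 'a form" where
  "Imp \<alpha> \<beta> \<equiv> Or (Neg \<alpha>) \<beta>"

(* Kleene's Hilbert-style axioms for classical propositional logic, read with
   implication as the abbreviation above. Interpreting a primitive implication
   this way maps Kleene derivations to derivations here, so the calculus is
   complete; all axioms are tautologies, so it is sound. *)
inductive deduces :: "'a form set \<Rightarrow> 'a form \<Rightarrow> bool" (infix "\<turnstile>" 50)
  for \<Gamma> :: "'a form set" where
  hyp: "\<alpha> \<in> \<Gamma> \<Longrightarrow> \<Gamma> \<turnstile> \<alpha>"
| mp: "\<Gamma> \<turnstile> Imp \<alpha> \<beta> \<Longrightarrow> \<Gamma> \<turnstile> \<alpha> \<Longrightarrow> \<Gamma> \<turnstile> \<beta>"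
| imp_K: "\<Gamma> \<turnstile> Imp \<alpha> (Imp \<beta> \<alpha>)"
| imp_S: "\<Gamma> \<turnstile> Imp (Imp \<alpha> (Imp \<beta> \<gamma>)) (Imp (Imp \<alpha> \<beta>) (Imp \<alpha> \<gamma>))"
| and_intro: "\<Gamma> \<turnstile> Imp \<alpha> (Imp \<beta> (And \<alpha> \<beta>))"
| and_elim1: "\<Gamma> \<turnstile> Imp (And \<alpha> \<beta>) \<alpha>"
| and_elim2: "\<Gamma> \<turnstile> Imp (And \<alpha> \<beta>) \<beta>"
| or_intro1: "\<Gamma> \<turnstile> Imp \<alpha> (Or \<alpha> \<beta>)"
| or_intro2: "\<Gamma> \<turnstile> Imp \<beta> (Or \<alpha> \<beta>)"
| or_elim: "\<Gamma> \<turnstile> Imp (Imp \<alpha> \<gamma>) (Imp (Imp \<beta> \<gamma>) (Imp (Or \<alpha> \<beta>) \<gamma>))"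
| neg_intro: "\<Gamma> \<turnstile> Imp (Imp \<alpha> \<beta>) (Imp (Imp \<alpha> (Neg \<beta>)) (Neg \<alpha>))"
| neg_elim: "\<Gamma> \<turnstile> Imp (Neg (Neg \<alpha>)) \<alpha>"

(* A set of classes is used as a set of premises through all representatives
   of its members. *)
definition consistent :: "'a lindenbaum set \<Rightarrow> bool" where
  "consistent \<Sigma> \<longleftrightarrow>
     \<not> (\<exists>\<alpha>. {\<phi>. abs_lindenbaum \<phi> \<in> \<Sigma>} \<turnstile> \<alpha> \<and> {\<phi>. abs_lindenbaum \<phi> \<in> \<Sigma>} \<turnstile> Neg \<alpha>)"

definition maximal_consistent :: "'a lindenbaum set \<Rightarrow> bool" where
  "maximal_consistent \<Sigma> \<longleftrightarrow>
     consistent \<Sigma> \<and> (\<forall>\<Delta>. consistent \<Delta> \<and> \<Sigma> \<subseteq> \<Delta> \<longrightarrow> \<Delta> = \<Sigma>)"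

(* Commutative ring, possibly without a multiplicative identity (the HOL-Algebra
   locale cring demands one). The operations are total on the type, so closure
   of R under both of them is part of the definition: for addition it is
   contained in comm_group. *)
definition comm_rng_on :: "'b set \<Rightarrow> ('b \<Rightarrow> 'b \<Rightarrow> 'b) \<Rightarrow> ('b \<Rightarrow> 'b \<Rightarrow> 'b) \<Rightarrow> bool" where
  "comm_rng_on R add mul \<longleftrightarrow>
     (\<exists>z. comm_group \<lparr>carrier = R, mult = add, one = z\<rparr>) \<and>
     (\<forall>x\<in>R. \<forall>y\<in>R. mul x y \<in> R) \<and>
     (\<forall>x\<in>R. \<forall>y\<in>R. \<forall>z\<in>R. mul (mul x y) z = mul x (mul y z)) \<and>
     (\<forall>x\<in>R. \<forall>y\<in>R. mul x y = mul y x) \<and>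
     (\<forall>x\<in>R. \<forall>y\<in>R. \<forall>z\<in>R. mul x (add y z) = add (mul x y) (mul x z)) \<and>
     (\<forall>x\<in>R. \<forall>y\<in>R. \<forall>z\<in>R. mul (add x y) z = add (mul x z) (mul y z))"

end

theory Submission
  imports Defs
begin

text \<open>
  The ring laws are boolean identities, with the top class as zero and every class its own
  additive inverse, so the only real point is that a maximal consistent set contains the top class
  and is closed under the operations. This needs no completeness theorem. The set of
  representatives of a set of classes is closed under equivalence, so as soon as it contains some
  \<open>\<alpha>\<close> it contains \<open>\<alpha> \<and> \<tau>\<close> for every tautology \<open>\<tau>\<close>, and thus derives \<open>\<tau>\<close>. Nonemptiness follows from
  soundness, which shows that the top class alone is consistent.
\<close>

definition representatives :: "'a lindenbaum set \<Rightarrow> 'a form set" where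
  "representatives \<Sigma> = {\<phi>. abs_lindenbaum \<phi> \<in> \<Sigma>}"

lemma consistent_iff:
  "consistent \<Sigma> \<longleftrightarrow> \<not> (\<exists>\<alpha>. representatives \<Sigma> \<turnstile> \<alpha> \<and> representatives \<Sigma> \<turnstile> Neg \<alpha>)"
  by (simp add: consistent_def representatives_def)

lemma abs_lindenbaum_eq_iff: "abs_lindenbaum \<alpha> = abs_lindenbaum \<beta> \<longleftrightarrow> form_equiv \<alpha> \<beta>"
  using Quotient_rel[OF Quotient_lindenbaum, of \<alpha> \<beta>] by (simp add: form_equiv_def)

lemma deduces_sound:
  assumes "\<Gamma> \<turnstile> \<alpha>" and "\<And>\<gamma>. \<gamma> \<in> \<Gamma> \<Longrightarrow> eval_form v \<gamma>"
  shows "eval_form v \<alpha>"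
  using assms by (induction rule: deduces.induct) auto

text \<open>By induction, each use of a premise from \<Delta> is replaced by its derivation from
  \<Gamma>. This carries a contradiction in an enlarged premise set back to the original
  one.\<close>

lemma deduces_cut:
  assumes "\<Delta> \<turnstile> \<alpha>" and "\<And>\<delta>. \<delta> \<in> \<Delta> \<Longrightarrow> \<Gamma> \<turnstile> \<delta>"
  shows "\<Gamma> \<turnstile> \<alpha>"
  using assms(1)
proof (induction rule: deduces.induct)
  case (mp \<alpha> \<beta>)
  show ?case using mp.IH by (rule deduces.mp)
\<comment> \<open>\<open>assms(2)\<close> settles the \<open>hyp\<close> case;
  \<open>deduces.intros(3-)\<close> are the axiom schemes, available from any premises.\<close>
qed (rule assms(2) deduces.intros(3-); assumption?)+

lemma deduces_And:
  assumes "\<Gamma> \<turnstile> \<alpha>" and "\<Gamma> \<turnstile> \<beta>"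
  shows "\<Gamma> \<turnstile> And \<alpha> \<beta>"
  by (rule deduces.mp[OF deduces.mp[OF deduces.and_intro assms(1)] assms(2)])

lemma representatives_deduce_tautology:
  assumes "\<Sigma> \<noteq> {}" and "\<And>v. eval_form v \<tau>"
  shows "representatives \<Sigma> \<turnstile> \<tau>"
proof -
  obtain \<alpha> where \<alpha>: "abs_lindenbaum \<alpha> \<in> \<Sigma>"
    using assms(1) Quotient_abs_rep[OF Quotient_lindenbaum] by (metis all_not_in_conv)
  have "abs_lindenbaum (And \<alpha> \<tau>) = abs_lindenbaum \<alpha>"
    using assms(2) by (simp add: abs_lindenbaum_eq_iff form_equiv_def)
  with \<alpha> have "And \<alpha> \<tau> \<in> representatives \<Sigma>"
    by (simp add: representatives_def)
  then show ?thesis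
    by (rule deduces.mp[OF deduces.and_elim2 deduces.hyp])
qed

text \<open>The entailment makes \<open>Imp \<alpha> \<beta>\<close> a tautology, so modus ponens
  applies. This takes the place of completeness below.\<close>

lemma representatives_deduce_entailed:
  assumes "\<Sigma> \<noteq> {}" and "representatives \<Sigma> \<turnstile> \<alpha>"
    and "\<And>v. eval_form v \<alpha> \<Longrightarrow> eval_form v \<beta>"
  shows "representatives \<Sigma> \<turnstile> \<beta>"
proof -
  have "representatives \<Sigma> \<turnstile> Imp \<alpha> \<beta>"
    using assms(1,3) by (intro representatives_deduce_tautology) auto
  then show ?thesis
    using assms(2) by (rule deduces.mp)
qed

text \<open>All representatives of the class are tautologies, so by soundness a derivable formula
  and its negation would both be true.\<close>

lemma consistent_singleton_tautology:
  assumes "\<And>v. eval_form v \<tau>"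
  shows "consistent {abs_lindenbaum \<tau>}"
proof -
  have "eval_form v \<gamma>" if "\<gamma> \<in> representatives {abs_lindenbaum \<tau>}" for v \<gamma>
    using that assms by (simp add: representatives_def abs_lindenbaum_eq_iff form_equiv_def)
  then show ?thesis
    unfolding consistent_iff by (metis deduces_sound eval_form.simps(2))
qed

lemma maximal_consistent_nonempty:
  assumes "maximal_consistent \<Sigma>"
  shows "\<Sigma> \<noteq> {}"
proof
  \<comment> \<open>Types are inhabited, so there is an atom with which to form excluded
    middle.\<close>
  fix x :: 'a
  assume "\<Sigma> = {}"
  moreover have "consistent {abs_lindenbaum (Or (Atom x) (Neg (Atom x)))}"
    by (rule consistent_singleton_tautology) simp
  ultimately show False
    using assms unfolding maximal_consistent_def by blast
qed

text \<open>Adjoining the class of a derivable formula yields no new consequences, so consistency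
  survives and maximality forces the class to be present already.\<close>

lemma maximal_consistent_deductively_closed:
  assumes max: "maximal_consistent \<Sigma>" and deduced: "representatives \<Sigma> \<turnstile> \<phi>"
  shows "abs_lindenbaum \<phi> \<in> \<Sigma>"
proof -
  let ?\<Delta> = "insert (abs_lindenbaum \<phi>) \<Sigma>"
  have "representatives \<Sigma> \<turnstile> \<delta>" if "\<delta> \<in> representatives ?\<Delta>" for \<delta>
  proof (cases "\<delta> \<in> representatives \<Sigma>")
    case True
    then show ?thesis by (rule deduces.hyp)
  next
    case False
    \<comment> \<open>The insertion adds every formula equivalent to \<phi>, not just \<phi>
      itself.\<close>
    with that have "form_equiv \<delta> \<phi>"
      by (simp add: representatives_def abs_lindenbaum_eq_iff)
    then show ?thesis
      using representatives_deduce_entailed[OF maximal_consistent_nonempty[OF max] deduced]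
      by (simp add: form_equiv_def)
  qed
  then have "consistent ?\<Delta>"
    using max unfolding maximal_consistent_def consistent_iff by (meson deduces_cut)
  then show ?thesis
    using max unfolding maximal_consistent_def by blast
qed

lemma maximal_consistent_entailed:
  assumes "maximal_consistent \<Sigma>" and "abs_lindenbaum \<alpha> \<in> \<Sigma>" and "abs_lindenbaum \<beta> \<in> \<Sigma>"
    and "\<And>v. eval_form v \<alpha> \<Longrightarrow> eval_form v \<beta> \<Longrightarrow> eval_form v \<gamma>"
  shows "abs_lindenbaum \<gamma> \<in> \<Sigma>"
proof -
  have "representatives \<Sigma> \<turnstile> And \<alpha> \<beta>"
    using assms(2,3) by (intro deduces_And deduces.hyp) (simp_all add: representatives_def)
  then have "representatives \<Sigma> \<turnstile> \<gamma>"
    using assms(4)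
    by (rule representatives_deduce_entailed[OF maximal_consistent_nonempty[OF assms(1)]]) auto
  with assms(1) show ?thesis
    by (rule maximal_consistent_deductively_closed)
qed

lemma maximal_consistent_lor:
  assumes "maximal_consistent \<Sigma>" and "x \<in> \<Sigma>" and "y \<in> \<Sigma>"
  shows "lor x y \<in> \<Sigma>"
  using assms(2,3)
proof (induct x rule: lindenbaum.abs_induct; induct y rule: lindenbaum.abs_induct)
  fix \<alpha> \<beta>
  assume "abs_lindenbaum \<alpha> \<in> \<Sigma>" and "abs_lindenbaum \<beta> \<in> \<Sigma>"
  with assms(1) show "lor (abs_lindenbaum \<alpha>) (abs_lindenbaum \<beta>) \<in> \<Sigma>"
    unfolding lor.abs_eq by (rule maximal_consistent_entailed) simp
qed

lemma maximal_consistent_lbic: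
  assumes "maximal_consistent \<Sigma>" and "x \<in> \<Sigma>" and "y \<in> \<Sigma>"
  shows "lbic x y \<in> \<Sigma>"
  using assms(2,3)
proof (induct x rule: lindenbaum.abs_induct; induct y rule: lindenbaum.abs_induct)
  fix \<alpha> \<beta>
  assume "abs_lindenbaum \<alpha> \<in> \<Sigma>" and "abs_lindenbaum \<beta> \<in> \<Sigma>"
  with assms(1) show "lbic (abs_lindenbaum \<alpha>) (abs_lindenbaum \<beta>) \<in> \<Sigma>"
    unfolding lbic_def lor.abs_eq lneg.abs_eq land.abs_eq
    by (rule maximal_consistent_entailed) simp
qed

text \<open>A parity argument: under a valuation, either side is true iff an even number of the
  three arguments are false.\<close>

lemma lbic_assoc: "lbic (lbic x y) z = lbic x (lbic y z)"
  unfolding lbic_def by transfer (auto simp: form_equiv_def)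

lemma lbic_commute: "lbic x y = lbic y x"
  unfolding lbic_def by transfer (auto simp: form_equiv_def)

lemma lbic_self_left: "lbic (lbic x x) y = y"
  unfolding lbic_def by transfer (auto simp: form_equiv_def)

text \<open>Both are the top class; hence \<open>lbic a a\<close> can be the zero for any
  \<open>a\<close>, and each element is its own inverse.\<close>

lemma lbic_self_eq: "lbic x x = lbic y y"
  unfolding lbic_def by transfer (auto simp: form_equiv_def)

lemma lor_assoc: "lor (lor x y) z = lor x (lor y z)"
  by transfer (auto simp: form_equiv_def)

lemma lor_commute: "lor x y = lor y x"
  by transfer (auto simp: form_equiv_def)

text \<open>Where \<open>x\<close> is true both sides are true; where it is false both reduce to
  \<open>lbic y z\<close>.\<close>

lemma lor_lbic_distrib: "lor x (lbic y z) = lbic (lor x y) (lor x z)"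
  unfolding lbic_def by transfer (auto simp: form_equiv_def)

text \<open>Writing the zero as \<open>lbic a a\<close> with \<open>a\<close> in \<open>R\<close>
  puts it in \<open>R\<close> by closure alone.\<close>

lemma comm_group_lbic:
  assumes closed: "\<And>x y. x \<in> R \<Longrightarrow> y \<in> R \<Longrightarrow> lbic x y \<in> R" and "a \<in> R"
  shows "comm_group \<lparr>carrier = R, mult = lbic, one = lbic a a\<rparr>"
proof (rule comm_groupI; simp)
  show "lbic x y \<in> R" if "x \<in> R" "y \<in> R" for x y
    using that by (rule closed)
  show "lbic a a \<in> R"
    using \<open>a \<in> R\<close> closed by blast
  show "\<exists>y\<in>R. lbic y x = lbic a a" if "x \<in> R" for x
    using that lbic_self_eq by blast
qed (rule lbic_assoc lbic_commute lbic_self_left)+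

theorem theorem3p9:
  fixes \<Sigma> \<Sigma>' :: "'a lindenbaum set"
  assumes "countable (UNIV :: 'a set)" and "infinite (UNIV :: 'a set)"
    and "consistent \<Sigma>"
    and "\<Sigma> \<subseteq> \<Sigma>'" and "maximal_consistent \<Sigma>'"
  shows "comm_rng_on \<Sigma>' lbic lor"
proof -
  note max = \<open>maximal_consistent \<Sigma>'\<close>
  obtain a where "a \<in> \<Sigma>'"
    using maximal_consistent_nonempty[OF max] by blast
  then have "comm_group \<lparr>carrier = \<Sigma>', mult = lbic, one = lbic a a\<rparr>"
    using comm_group_lbic maximal_consistent_lbic[OF max] by blast
  moreover have "lor (lbic x y) z = lbic (lor x z) (lor y z)" for x y z :: "'a lindenbaum"
    using lor_lbic_distrib[of z x y] by (simp add: lor_commute)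
  ultimately show ?thesis
    unfolding comm_rng_on_def
    by (intro conjI exI[of _ "lbic a a"] ballI)
      (assumption | rule maximal_consistent_lor[OF max] lor_assoc lor_commute lor_lbic_distrib)+
qed

end
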